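(* Let $\varepsilon\in\mathbb{R}$ satisfy $0<3\varepsilon<1$ and put $\alpha=2+\varepsilon$. Then there exists a sufficiently small $\delta=\delta(\alpha)>0$ such that the following holds. Let $v_0:\mathbb{Z}^3\to\mathbb{C}^3$ satisfy $v_0(0)=0$, $v_0(k)\perp k$ for all $k\neq0$, and $v_0(k)=\dfrac{c_0(k)}{|k|^{\alpha}}$ for $k\neq 0$, with $$\|v_0\|_\alpha=\sup_{k\in\mathbb{Z}^3\setminus\{0\}}|k|^\alpha|v_0(k)|\le\delta .$$ Then the three-dimensional Navier--Stokes system on the torus in Fourier form, $$v(t,k)=e^{-t|k|^2}v_0(k)+2\pi i\int_0^t e^{-(t-s)|k|^2}\sum_{l\in\mathbb{Z}^3}\langle k,v(s,k-l)\rangle\,P_k v(s,l)\,ds ,\qquad t\ge0,\ k\in\mathbb{Z}^3\setminus\{0\},$$ where $v(t,k)\in\mathbb{C}^3$, $v(t,k)\perp k$ for $k\ne0$ and $v(t,0)=0$, has a global solution (defined for all $t\in[0,\infty)$) of the form $v(t,k)=\dfrac{c(t,k)}{|k|^\alpha}$, $k\neq0$, such that $t\mapsto c(t,\cdot)$ is a continuous mapping of $[0,\infty)$ into $L^\infty(\mathbb{Z}^3\setminus\{0\})$.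
   Context: Here $|\cdot|$ is the Euclidean norm on $\mathbb{R}^3$ and the Hermitian norm on $\mathbb{C}^3$. For $k\in\mathbb{Z}^3$ and $w\in\mathbb{C}^3$, $\langle k,w\rangle=\sum_{j=1}^3k_jw_j$, and $w\perp k$ means $\langle k,w\rangle=0$. For $k\neq0$, $P_k:\mathbb{C}^3\to\mathbb{C}^3$ is the Leray projector onto the subspace orthogonal to $k$, $P_kw=w-\dfrac{\langle k,w\rangle}{|k|^2}\,k$. The condition $\|v_0\|_\alpha<\infty$ says that $v_0$ belongs to the space $\Phi(\alpha)$ of functions $f(k)=c(k)/|k|^\alpha$, $k\ne0$, with $\sup_k|c(k)|<\infty$, normed by $\|f\|_\alpha=\sup_{k\neq 0}|k|^\alpha|f(k)|$. $L^\infty(\mathbb{Z}^3\setminus\{0\})$ is the space of bounded $\mathbb{C}^3$-valued functions on $\mathbb{Z}^3\setminus\{0\}$ with the sup norm. The integral equation is the Navier--Stokes system with periodic boundary conditions after Fourier transform, with viscosity $1$ and no external forcing.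
   Formalization: Sup-norm continuity of c(t,·) at t=0 fails for general c_0 (e.g. |c_0(k)|=δ); proved instead: continuity on (0,∞), continuity of c(t,k)−e^{-t|k|²}c_0(k) on [0,∞), and continuity of c on all of [0,∞) when c_0(k)→0 as |k|→∞. *)

theory Defs
  imports "HOL-Analysis.Analysis"
begin

type_synonym freq = "int^3"
type_synonym field = "freq \<Rightarrow> complex^3"

definition znorm :: "freq \<Rightarrow> real" where
  "znorm k = norm ((\<chi> j. of_int (k $ j)) :: real^3)"

text \<open>The bilinear form, without complex conjugation.\<close>

definition pairing :: "freq \<Rightarrow> complex^3 \<Rightarrow> complex" where
  "pairing k w = (\<Sum>j\<in>UNIV. of_int (k $ j) * w $ j)"

definition leray :: "freq \<Rightarrow> complex^3 \<Rightarrow> complex^3" where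
  "leray k w = w - (pairing k w / of_real ((znorm k)\<^sup>2)) *s (\<chi> j. of_int (k $ j))"

text \<open>Only the values at \<open>k \<noteq> 0\<close> matter for membership in \<open>Phi \<alpha>\<close> and for the norm.\<close>

definition Phi :: "real \<Rightarrow> field set" where
  "Phi \<alpha> = {f. \<exists>c. bounded (c ` (- {0})) \<and> (\<forall>k. k \<noteq> 0 \<longrightarrow> f k = c k /\<^sub>R znorm k powr \<alpha>)}"

definition Phi_norm :: "real \<Rightarrow> field \<Rightarrow> real" where
  "Phi_norm \<alpha> f = (SUP k\<in>- {0}. znorm k powr \<alpha> * norm (f k))"

text \<open>The metric space of bounded functions on the nonzero frequencies with the supremum
  distance. Its elements are \<open>undefined\<close> at \<open>0\<close>, hence the \<open>restrict\<close> in the definition of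
  continuity. Continuity includes that every \<open>c t\<close> with \<open>t \<in> T\<close> is bounded.\<close>

definition Linf :: "field metric" where
  "Linf = funspace (- {0}) euclidean_metric"

definition continuous_into_Linf :: "real set \<Rightarrow> (real \<Rightarrow> field) \<Rightarrow> bool" where
  "continuous_into_Linf T c \<longleftrightarrow>
     continuous_map (top_of_set T) (mtopology_of Linf) (\<lambda>t. restrict (c t) (- {0}))"

text \<open>For bounded \<open>f\<close>, the map \<open>t \<mapsto> heat t f\<close> is norm-continuous into \<open>Linf\<close> on \<open>{0<..}\<close>, but at
  \<open>t = 0\<close> only if \<open>f\<close> vanishes at infinity: with \<open>t = 1 / \<bar>k\<bar>\<^sup>2\<close> the distance from \<open>heat t f\<close> to \<open>f\<close>
  is at least \<open>(1 - 1/e) * norm (f k)\<close>. A solution of the integral equation has the same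
  discontinuity at \<open>t = 0\<close>.\<close>

definition heat :: "real \<Rightarrow> field \<Rightarrow> field" where
  "heat t f = (\<lambda>k. exp (- t * (znorm k)\<^sup>2) *\<^sub>R f k)"

definition ns_solution :: "field \<Rightarrow> (real \<Rightarrow> field) \<Rightarrow> bool" where
  "ns_solution v\<^sub>0 v \<longleftrightarrow>
     (\<forall>t\<ge>0. v t 0 = 0 \<and>
       (\<forall>k. k \<noteq> 0 \<longrightarrow>
          pairing k (v t k) = 0 \<and>
          (\<lambda>l. pairing k (v t (k - l)) *s leray k (v t l)) summable_on UNIV \<and>
          set_integrable lborel {0..t}
            (\<lambda>s. exp (- (t - s) * (znorm k)\<^sup>2) *\<^sub>R
                   (\<Sum>\<^sub>\<infinity>l. pairing k (v s (k - l)) *s leray k (v s l))) \<and>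
          v t k = heat t v\<^sub>0 k + (2 * of_real pi * \<i>) *s
            (LINT s:{0..t}|lborel. exp (- (t - s) * (znorm k)\<^sup>2) *\<^sub>R
                   (\<Sum>\<^sub>\<infinity>l. pairing k (v s (k - l)) *s leray k (v s l)))))"

end

theory Submission
  imports Defs
begin

text \<open>Put \<open>\<beta> = 1 + 3\<epsilon>/2\<close>. As one of \<open>\<bar>k - l\<bar>\<close> and \<open>\<bar>l\<bar>\<close> is at least \<open>\<bar>k\<bar>/2\<close>, the lattice convolution of
  \<open>\<bar>k\<bar>\<^bsup>-\<alpha>\<^esup>\<close> with itself is \<open>O(\<bar>k\<bar>\<^bsup>-\<beta>\<^esup>)\<close>. The nonlinearity contributes one factor \<open>\<bar>k\<bar>\<close> and the time
  integral of the heat kernel a factor \<open>\<bar>k\<bar>\<^bsup>-2\<^esup>\<close>, uniformly in time, so the Duhamel term, rescaled by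
  \<open>\<bar>k\<bar>\<^bsup>\<alpha>\<^esup>\<close>, is \<open>O(\<bar>k\<bar>\<^bsup>-\<epsilon>/2\<^esup>)\<close> and quadratic in the size of the solution. Hence the integral equation
  is a contraction on a small ball of bounded functions of time and frequency, globally in time.
  Orthogonality to \<open>k\<close> needs no constraint in the fixed point problem: the Leray projector enforces it.
  A family which is continuous in time for each frequency and decays in frequency uniformly in time
  is continuous into \<open>Linf\<close>. The Duhamel term is of this kind on \<open>{0..}\<close>; the heat flow of \<open>c\<^sub>0\<close> is on
  \<open>{0<..}\<close>, and on \<open>{0..}\<close> if \<open>c\<^sub>0\<close> vanishes at infinity.\<close>

subsection \<open>Lattice sums\<close>

lemma znorm_nonneg [simp]: "0 \<le> znorm k"
  by (simp add: znorm_def)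

lemma znorm_0 [simp]: "znorm 0 = 0"
  by (simp add: znorm_def zero_vec_def [symmetric])

lemma abs_component_le_znorm: "\<bar>of_int (k $ j)\<bar> \<le> znorm k"
  unfolding znorm_def using component_le_norm_cart [of "(\<chi> j. of_int (k $ j)) :: real^3" j] by simp

lemma znorm_ge_1: "k \<noteq> 0 \<Longrightarrow> 1 \<le> znorm k"
proof -
  assume "k \<noteq> 0"
  then obtain j where "k $ j \<noteq> 0"
    by (auto simp: vec_eq_iff)
  then have "1 \<le> \<bar>real_of_int (k $ j)\<bar>"
    by linarith
  then show ?thesis
    using abs_component_le_znorm [of k j] by linarith
qed

lemma znorm_triangle: "znorm (k + l) \<le> znorm k + znorm l"
proof -
  have "((\<chi> j. of_int ((k + l) $ j)) :: real^3) = (\<chi> j. of_int (k $ j)) + (\<chi> j. of_int (l $ j))"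
    by (simp add: vec_eq_iff)
  then show ?thesis
    unfolding znorm_def by (metis norm_triangle_ineq)
qed

lemma finite_znorm_le: "finite {k. znorm k \<le> R}"
proof -
  let ?B = "{-\<lceil>R\<rceil>..\<lceil>R\<rceil>}"
  have "{k. znorm k \<le> R} \<subseteq> vec_lambda ` (PiE (UNIV :: 3 set) (\<lambda>_. ?B))"
  proof
    fix k assume "k \<in> {k. znorm k \<le> R}"
    then have "\<bar>real_of_int (k $ j)\<bar> \<le> R" for j
      using abs_component_le_znorm [of k j] by simp
    then have "k $ j \<in> ?B" for j
      by (smt (verit) atLeastAtMost_iff le_of_int_ceiling of_int_le_iff of_int_minus)
    then have "vec_nth k \<in> PiE UNIV (\<lambda>_. ?B)"
      by auto
    then show "k \<in> vec_lambda ` (PiE UNIV (\<lambda>_. ?B))"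
      by (metis image_eqI vec_nth_inverse)
  qed
  then show ?thesis
    by (rule finite_subset) (intro finite_imageI finite_PiE, auto)
qed

text \<open>Decay at infinity is expressed through \<open>cofinite\<close>: every ball contains
  finitely many frequencies, so \<open>znorm\<close> tends to infinity along this filter.\<close>

lemma znorm_powr_tendsto_0:
  assumes "0 < a"
  shows "((\<lambda>k. C * znorm k powr - a) \<longlongrightarrow> 0) cofinite"
proof -
  have "finite {k. \<not> R \<le> znorm k}" for R
    by (rule finite_subset [OF _ finite_znorm_le [of R]]) auto
  then have "filterlim znorm at_top cofinite"
    by (simp add: filterlim_at_top eventually_cofinite)
  then have "((\<lambda>k. znorm k powr - a) \<longlongrightarrow> 0) cofinite"
    using assms by (intro tendsto_neg_powr) auto
  then show ?thesis
    using tendsto_mult_right_zero by blast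
qed

lemma summable_on_int_powr:
  assumes "1 < p"
  shows "(\<lambda>n::int. (1 + \<bar>of_int n\<bar>) powr - p :: real) summable_on UNIV"
proof -
  let ?f = "\<lambda>n::int. (1 + \<bar>of_int n\<bar>) powr - p :: real"
  have s: "summable (\<lambda>n. of_nat n powr - p :: real)"
    using assms by (simp add: summable_real_powr_iff)
  then have "summable (\<lambda>n. of_nat (Suc n) powr - p :: real)"
    by (subst summable_Suc_iff)
  then have n: "(\<lambda>n. of_nat (Suc n) powr - p :: real) summable_on UNIV"
    by (subst summable_on_UNIV_nonneg_real_iff) auto
  have "?f summable_on range int"
    by (subst summable_on_reindex) (use n in \<open>auto simp: o_def add.commute\<close>)
  moreover have "?f summable_on range (\<lambda>n. - int n)"
    by (subst summable_on_reindex) (use n in \<open>auto simp: o_def add.commute inj_on_def\<close>)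
  ultimately have "?f summable_on (range int \<union> range (\<lambda>n. - int n))"
    by (rule summable_on_union)
  moreover have "range int \<union> range (\<lambda>n. - int n) = UNIV"
  proof -
    have "x \<in> range int \<union> range (\<lambda>n. - int n)" for x
      by (cases x rule: int_cases2) auto
    then show ?thesis by auto
  qed
  ultimately show ?thesis by simp
qed

text \<open>For k \<noteq> 0 each coordinate satisfies 1 + |k_j| \<le> 2|k|. Hence |k|^(-p) is at
  most 2^p times the product of the three factors (1 + |k_j|)^(-p/3), which is summable because p/3
  > 1.\<close>

lemma summable_znorm_powr:
  assumes "3 < p"
  shows "(\<lambda>k. znorm k powr - p) summable_on UNIV"
proof -
  define f where "f = (\<lambda>n::int. (1 + \<bar>of_int n\<bar>) powr - (p / 3) :: real)"
  have f: "f summable_on UNIV"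
    unfolding f_def by (rule summable_on_int_powr) (use assms in simp)
  have f0: "0 \<le> f n" for n
    by (simp add: f_def)
  have bij: "bij_betw vec_lambda (PiE (UNIV :: 3 set) (\<lambda>_. UNIV)) (UNIV :: freq set)"
    by (rule bij_betw_byWitness [where f' = vec_nth]) auto
  have "Infinite_Set_Sum.abs_summable_on (\<lambda>g. \<Prod>j\<in>(UNIV :: 3 set). f (g j)) (PiE UNIV (\<lambda>_. UNIV))"
    by (rule Infinite_Set_Sum.abs_summable_on_prod_PiE)
      (use f f0 in \<open>auto simp flip: abs_summable_equivalent\<close>)
  then have "(\<lambda>g. \<Prod>j\<in>(UNIV :: 3 set). f (g j)) summable_on PiE UNIV (\<lambda>_. UNIV)"
    using Infinite_Sum.abs_summable_summable abs_summable_equivalent by blast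
  then have "(\<lambda>k. \<Prod>j\<in>UNIV. f (k $ j)) summable_on (UNIV :: freq set)"
    by (subst summable_on_reindex_bij_betw [OF bij, symmetric]) simp
  then have "(\<lambda>k. 2 powr p * (\<Prod>j\<in>UNIV. f (k $ j))) summable_on (UNIV :: freq set)"
    by (rule summable_on_cmult_right)
  then show ?thesis
  proof (rule summable_on_comparison_test)
    fix k :: freq
    show "znorm k powr - p \<le> 2 powr p * (\<Prod>j\<in>UNIV. f (k $ j))"
    \<comment> \<open>\<open>0 powr x\<close> is 0 for every \<open>x\<close>, so the term at the
      origin is 0 despite the negative exponent.\<close>
    proof (cases "k = 0")
      case True
      then show ?thesis by (simp add: prod_nonneg f0)
    next
      case False
      define x where "x = 2 * znorm k"
      have x: "2 \<le> x"
        using znorm_ge_1 [OF False] by (simp add: x_def)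
      have "x powr - (p / 3) \<le> f (k $ j)" for j
        unfolding f_def
        by (rule powr_mono2')
          (use abs_component_le_znorm [of k j] znorm_ge_1 [OF False] assms in \<open>auto simp: x_def\<close>)
      then have "(\<Prod>j\<in>(UNIV :: 3 set). x powr - (p / 3)) \<le> (\<Prod>j\<in>UNIV. f (k $ j))"
        by (intro prod_mono) auto
      moreover have "(\<Prod>j\<in>(UNIV :: 3 set). x powr - (p / 3)) = x powr - p"
        using x by (simp add: powr_power)
      moreover have "x powr - p = 2 powr - p * znorm k powr - p"
        by (simp add: x_def powr_mult)
      ultimately have "2 powr p * (2 powr - p * znorm k powr - p) \<le> 2 powr p * (\<Prod>j\<in>UNIV. f (k $ j))"
        by (intro mult_left_mono) auto
      then show ?thesis
        by (simp add: mult.assoc [symmetric] flip: powr_add)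
    qed
  qed auto
qed

text \<open>The exponent p of the larger factor \<open>a\<close> is split: the share q is spent on a
  \<ge> x/2, the rest p - q is passed on to b \<le> a.\<close>

lemma powr_convolution_aux:
  fixes a b x q p r :: real
  assumes "0 < b" "b \<le> a" "x \<le> 2 * a" "0 < x" "0 \<le> q" "q \<le> p"
  shows "a powr - p * b powr - r \<le> (x / 2) powr - q * b powr - (p + r - q)"
proof -
  have "a powr - p = a powr - q * a powr - (p - q)"
    by (simp flip: powr_add)
  also have "\<dots> \<le> (x / 2) powr - q * b powr - (p - q)"
    by (intro mult_mono powr_mono2') (use assms in auto)
  finally have "a powr - p * b powr - r \<le> (x / 2) powr - q * b powr - (p - q) * b powr - r"
    by (rule mult_right_mono) auto
  also have "\<dots> = (x / 2) powr - q * b powr - (p + r - q)"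
    by (simp add: mult.assoc algebra_simps flip: powr_add)
  finally show ?thesis .
qed

text \<open>By the triangle inequality the larger of |k - l| and |l| is at least |k|/2. The share q
  of its exponent yields the decay in k, and the smaller factor is left with the exponent 2p - q >
  3, which is summable. Adding \<open>Z (k - l)\<close> and \<open>Z l\<close> covers both cases at
  once.\<close>

lemma convolution_bound:
  assumes "3 < 2 * p - q" "0 \<le> q" "q \<le> p"
  obtains C where "0 < C"
    "\<And>k. (\<lambda>l. znorm (k - l) powr - p * znorm l powr - p) summable_on UNIV"
    "\<And>k. k \<noteq> 0 \<Longrightarrow> (\<Sum>\<^sub>\<infinity>l. znorm (k - l) powr - p * znorm l powr - p) \<le> C * znorm k powr - q"
proof -
  define Z where "Z = (\<lambda>l. znorm l powr - (2 * p - q))"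
  have Z: "Z summable_on UNIV"
    unfolding Z_def by (rule summable_znorm_powr) fact
  have bij: "bij_betw (\<lambda>l. k - l) UNIV UNIV" for k :: freq
    by (rule bij_betw_byWitness [where f' = "\<lambda>l. k - l"]) auto
  have Zk: "(\<lambda>l. Z (k - l)) summable_on UNIV" for k
    using Z summable_on_reindex_bij_betw [OF bij, of Z k] by simp
  have Zk_eq: "(\<Sum>\<^sub>\<infinity>l. Z (k - l)) = (\<Sum>\<^sub>\<infinity>l. Z l)" for k
    using infsum_reindex_bij_betw [OF bij, of Z k] by simp
  have ptw: "znorm (k - l) powr - p * znorm l powr - p \<le> (znorm k / 2) powr - q * (Z (k - l) + Z l)"
    if "k \<noteq> 0" for k l
  \<comment> \<open>Here one factor on the left is \<open>0 powr - p\<close>, which is 0.\<close>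
  proof (cases "l = 0 \<or> k = l")
    case True
    then show ?thesis by (auto simp: Z_def)
  next
    case False
    define a b x where "a = znorm (k - l)" and "b = znorm l" and "x = znorm k"
    have pos: "0 < a" "0 < b" "0 < x"
      using False that znorm_ge_1 [of "k - l"] znorm_ge_1 [of l] znorm_ge_1 [of k]
      by (auto simp: a_def b_def x_def)
    have tri: "x \<le> a + b"
      using znorm_triangle [of "k - l" l] by (simp add: a_def b_def x_def)
    show ?thesis
    proof (cases "b \<le> a")
      case True
      have "a powr - p * b powr - p \<le> (x / 2) powr - q * b powr - (p + p - q)"
        by (rule powr_convolution_aux) (use True pos tri assms in auto)
      also have "\<dots> \<le> (x / 2) powr - q * (Z (k - l) + Z l)"
        by (rule mult_left_mono) (auto simp: Z_def b_def)
      finally show ?thesis by (simp add: a_def b_def x_def)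
    next
      case False
      have "b powr - p * a powr - p \<le> (x / 2) powr - q * a powr - (p + p - q)"
        by (rule powr_convolution_aux) (use False pos tri assms in auto)
      also have "\<dots> \<le> (x / 2) powr - q * (Z (k - l) + Z l)"
        by (rule mult_left_mono) (auto simp: Z_def a_def)
      finally show ?thesis by (simp add: a_def b_def x_def mult.commute)
    qed
  qed
  have s: "(\<lambda>l. (znorm k / 2) powr - q * (Z (k - l) + Z l)) summable_on UNIV" for k
    by (intro summable_on_cmult_right summable_on_add Zk Z)
  have summ: "(\<lambda>l. znorm (k - l) powr - p * znorm l powr - p) summable_on UNIV" for k
  proof (cases "k = 0")
    \<comment> \<open>The pointwise bound excludes k = 0. There the summand is |l|^(-2p), and 2p > 3
      + q \<ge> 3.\<close>
    case True
    have "znorm (- l) = znorm l" for l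
    proof -
      have "((\<chi> j. of_int ((- l) $ j)) :: real^3) = - (\<chi> j. of_int (l $ j))"
        by (simp add: vec_eq_iff)
      then show ?thesis by (metis norm_minus_cancel znorm_def)
    qed
    moreover have "(\<lambda>l. znorm l powr - (2 * p)) summable_on UNIV"
      by (rule summable_znorm_powr) (use assms in simp)
    ultimately show ?thesis
      using True by (simp flip: powr_add)
  next
    case False
    show ?thesis
      by (rule summable_on_comparison_test [OF s]) (auto intro: ptw [OF False])
  qed
  \<comment> \<open>The added 1 makes \<open>C\<close> positive without a positive lower bound for
    the sum.\<close>
  define C where "C = 2 powr q * (2 * infsum Z UNIV) + 1"
  have "0 \<le> infsum Z UNIV"
    by (rule infsum_nonneg) (simp add: Z_def)
  then have "0 < C"
    by (simp add: C_def add_nonneg_pos)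
  moreover have "(\<Sum>\<^sub>\<infinity>l. znorm (k - l) powr - p * znorm l powr - p) \<le> C * znorm k powr - q"
    if "k \<noteq> 0" for k
  proof -
    have "(\<Sum>\<^sub>\<infinity>l. znorm (k - l) powr - p * znorm l powr - p)
        \<le> (\<Sum>\<^sub>\<infinity>l. (znorm k / 2) powr - q * (Z (k - l) + Z l))"
      by (rule infsum_mono [OF summ s]) (rule ptw [OF that])
    also have "\<dots> = (znorm k / 2) powr - q * (2 * infsum Z UNIV)"
      by (simp add: infsum_cmult_right' infsum_add Zk Z Zk_eq)
    also have "\<dots> = 2 powr q * (2 * infsum Z UNIV) * znorm k powr - q"
      by (simp add: powr_divide powr_minus field_simps)
    also have "\<dots> \<le> C * znorm k powr - q"
      by (rule mult_right_mono) (auto simp: C_def)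
    finally show ?thesis .
  qed
  ultimately show ?thesis
    using summ that by blast
qed

subsection \<open>The bilinear term\<close>

lemma znorm_eq_0_iff [simp]: "znorm k = 0 \<longleftrightarrow> k = 0"
  using znorm_ge_1 [of k] by fastforce

lemma norm_smult_complex: "norm (c *s (w :: complex^'n)) = norm c * norm w"
  by (simp add: norm_vec_def norm_mult L2_set_right_distrib)

lemma norm_of_int_vec: "norm ((\<chi> j. of_int (k $ j)) :: complex^3) = znorm k"
  by (simp add: znorm_def norm_vec_def)

lemma norm_pairing_le: "norm (pairing k w) \<le> znorm k * norm w"
proof -
  have "norm (pairing k w) \<le> (\<Sum>j\<in>UNIV. \<bar>of_int (k $ j)\<bar> * norm (w $ j))"
    unfolding pairing_def by (rule order_trans [OF norm_sum]) (simp add: norm_mult)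
  also have "\<dots> \<le> L2_set (\<lambda>j. of_int (k $ j)) UNIV * L2_set (\<lambda>j. norm (w $ j)) UNIV"
    using L2_set_mult_ineq [of "\<lambda>j. of_int (k $ j)" "\<lambda>j. norm (w $ j)" UNIV] by simp
  also have "\<dots> = znorm k * norm w"
    by (simp add: znorm_def norm_vec_def L2_set_def)
  finally show ?thesis .
qed

text \<open>The triangle inequality gives the factor 2, which suffices here; orthogonality of the
  projector would give 1. At k = 0 the subtracted vector is 0.\<close>

lemma norm_leray_le: "norm (leray k w) \<le> 2 * norm w"
proof (cases "k = 0")
  case True
  then show ?thesis by (simp add: leray_def)
next
  case False
  have "norm (leray k w) \<le> norm w + norm (pairing k w) / (znorm k)\<^sup>2 * znorm k"
    unfolding leray_def
    by (rule order_trans [OF norm_triangle_ineq4])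
      (simp add: norm_smult_complex norm_of_int_vec norm_divide norm_power)
  also have "norm (pairing k w) / (znorm k)\<^sup>2 * znorm k \<le> (znorm k * norm w) / (znorm k)\<^sup>2 * znorm k"
    by (intro mult_right_mono divide_right_mono norm_pairing_le) auto
  also have "\<dots> = norm w"
    using False by (simp add: power2_eq_square)
  finally show ?thesis by simp
qed

lemma linear_pairing: "linear (pairing k)"
  by (rule linearI) (simp_all add: pairing_def sum.distrib algebra_simps sum_distrib_left scaleR_sum_right)

lemma linear_leray: "linear (leray k)"
proof (rule linearI)
  show "leray k (v + w) = leray k v + leray k w" for v w
    unfolding leray_def linear_add [OF linear_pairing]
    by (simp add: vec_eq_iff add_divide_distrib algebra_simps)
  show "leray k (r *\<^sub>R w) = r *\<^sub>R leray k w" for r w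
    unfolding leray_def linear_cmul [OF linear_pairing]
    by (simp add: vec_eq_iff scaleR_conv_of_real[where 'a=complex] algebra_simps)
qed

text \<open>Boundedness allows \<open>pairing k\<close> to be moved through infinite sums and
  integrals.\<close>

lemma bounded_linear_pairing: "bounded_linear (pairing k)"
  by (simp add: linear_conv_bounded_linear [symmetric] linear_pairing)

lemma bounded_linear_leray: "bounded_linear (leray k)"
  by (simp add: linear_conv_bounded_linear [symmetric] linear_leray)

lemma pairing_smult: "pairing k (c *s w) = c * pairing k w"
  by (simp add: pairing_def sum_distrib_left algebra_simps)

lemma pairing_of_int_vec: "pairing k (\<chi> j. of_int (k $ j)) = of_real ((znorm k)\<^sup>2)"
proof -
  have "(znorm k)\<^sup>2 = (\<Sum>j\<in>UNIV. (real_of_int (k $ j))\<^sup>2)"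
    by (simp add: znorm_def norm_vec_def L2_set_def sum_nonneg)
  then show ?thesis
    by (simp add: pairing_def power2_eq_square)
qed

lemma pairing_leray: "pairing k (leray k w) = 0"
proof (cases "k = 0")
  case True
  then show ?thesis by (simp add: pairing_def)
next
  case False
  then show ?thesis
    by (simp add: leray_def linear_diff [OF linear_pairing] pairing_smult pairing_of_int_vec)
qed

text \<open>The two velocity arguments are kept apart so that bilinearity can be used on differences
  of solutions.\<close>

definition advection :: "field \<Rightarrow> field \<Rightarrow> freq \<Rightarrow> freq \<Rightarrow> complex^3" where
  "advection u w k l = pairing k (u (k - l)) *s leray k (w l)"

lemma norm_advection_le:
  assumes "norm (u (k - l)) \<le> a" "norm (w l) \<le> b"
  shows "norm (advection u w k l) \<le> 2 * znorm k * (a * b)"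
proof -
  have a: "0 \<le> a"
    using assms(1) norm_ge_zero order_trans by blast
  have "norm (advection u w k l) \<le> (znorm k * norm (u (k - l))) * (2 * norm (w l))"
    unfolding advection_def norm_smult_complex
    by (intro mult_mono norm_pairing_le norm_leray_le) auto
  also have "\<dots> \<le> (znorm k * a) * (2 * b)"
    by (intro mult_mono assms mult_left_mono) (use a in auto)
  finally show ?thesis by (simp add: algebra_simps)
qed

text \<open>Polarization of the quadratic term: each summand on the right contains the difference
  once, which yields the Lipschitz estimate for the contraction.\<close>

lemma advection_diff:
  "advection u u k l - advection w w k l = advection (u - w) u k l + advection w (u - w) k l"
  by (simp add: advection_def linear_diff [OF linear_pairing] linear_diff [OF linear_leray] algebra_simps
    vec_eq_iff)

lemma pairing_infsum_eq_0:
  assumes "f summable_on UNIV" "\<And>l. pairing k (f l) = 0"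
  shows "pairing k (\<Sum>\<^sub>\<infinity>l. f l) = 0"
  using infsumI [OF has_sum_bounded_linear [OF bounded_linear_pairing [of k] has_sum_infsum [OF assms(1)]]] assms(2)
  by simp

lemma pairing_advection: "pairing k (advection u w k l) = 0"
  by (simp add: advection_def pairing_smult pairing_leray)

subsection \<open>Continuity into \<open>Linf\<close>\<close>

text \<open>The majorant makes all but finitely many frequencies uniformly small near
  \<open>t\<close>; on the finite rest, pointwise continuity suffices. The majorant is only local in
  time, so it may blow up towards an endpoint missing from \<open>T\<close>.\<close>

lemma continuous_map_LinfI:
  fixes f :: "real \<Rightarrow> field"
  assumes cont: "\<And>k. k \<noteq> 0 \<Longrightarrow> continuous_on T (\<lambda>t. f t k)"
    and dec: "\<And>t. t \<in> T \<Longrightarrow> \<exists>S g. open S \<and> t \<in> S \<and> (g \<longlongrightarrow> 0) cofinite \<and>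
      (\<forall>s\<in>S \<inter> T. \<forall>k. k \<noteq> 0 \<longrightarrow> norm (f s k) \<le> g k)"
  shows "continuous_into_Linf T f"
proof -
  let ?S = "- {0 :: freq}"
  interpret L: Metric_space "Met_TC.fspace ?S :: field set" "Met_TC.fdist ?S"
    by (rule Met_TC.Metric_space_funspace)
  define r where "r t = restrict (f t) ?S" for t
  \<comment> \<open>A supremum can be bounded through its terms only over a nonempty set.\<close>
  have "(\<chi> i. 1) \<in> ?S"
    by (simp add: vec_eq_iff)
  then have ne: "?S \<noteq> {}"
    by blast
  have mem: "r t \<in> Met_TC.fspace ?S" if t: "t \<in> T" for t
  proof -
    from dec [OF t] obtain S g where g: "open S" "t \<in> S" "(g \<longlongrightarrow> 0) cofinite"
      and bound: "\<forall>s\<in>S \<inter> T. \<forall>k. k \<noteq> 0 \<longrightarrow> norm (f s k) \<le> g k"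
      by (elim exE conjE) (rule that)
    have "eventually (\<lambda>k. g k < 1) cofinite"
      using order_tendstoD(2) [OF g(3), of 1] by simp
    then have fin: "finite {k. \<not> g k < 1}"
      by (simp add: eventually_cofinite)
    \<comment> \<open>Only finitely many values of \<open>g\<close> reach 1, so \<open>M\<close>
      bounds them all; this places the restricted function in the space of bounded
      functions.\<close>
    define M where "M = Max (insert 1 (g ` {k. \<not> g k < 1}))"
    have "g k \<le> M" for k
    proof (cases "g k < 1")
      case True
      have "1 \<le> M" unfolding M_def using fin by (intro Max_ge) auto
      with True show ?thesis by simp
    next
      case False
      then show ?thesis unfolding M_def using fin by (intro Max_ge) auto
    qed
    then have "norm (f t k) \<le> M" if "k \<noteq> 0" for k
      using bound g(2) t that by (meson IntI order_trans)
    then have "Met_TC.mbounded (r t ` ?S)"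
      unfolding Met_TC.mbounded_def Met_TC.mcball_def r_def
      by (intro exI [of _ 0] exI [of _ M]) auto
    then show ?thesis
      by (simp add: Met_TC.fspace_def r_def)
  qed
  have top: "mtopology_of Linf = L.mtopology"
    by (simp add: mtopology_of_def Linf_def)
  have "\<exists>U. openin (top_of_set T) U \<and> t \<in> U \<and> (\<forall>s\<in>U. r s \<in> L.mball (r t) e)"
    if t: "t \<in> T" and e: "0 < e" for t e
  proof -
    from dec [OF t] obtain S g where g: "open S" "t \<in> S" "(g \<longlongrightarrow> 0) cofinite"
      and bound: "\<forall>s\<in>S \<inter> T. \<forall>k. k \<noteq> 0 \<longrightarrow> norm (f s k) \<le> g k"
      by (elim exE conjE) (rule that)
    \<comment> \<open>Two tails below e/4 differ by at most e/2. The supremum of the distances is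
      then at most e/2, which is strictly below e.\<close>
    have "eventually (\<lambda>k. g k < e / 4) cofinite"
      using order_tendstoD(2) [OF g(3), of "e / 4"] e by simp
    then have fin: "finite {k. \<not> g k < e / 4}"
      by (simp add: eventually_cofinite)
    have "\<forall>\<^sub>F s in at t within T. dist (f s k) (f t k) < e / 2" if "k \<noteq> 0" for k
      using cont [OF that] t e unfolding continuous_on_def by (intro tendstoD) auto
    then have "\<forall>\<^sub>F s in at t within T. \<forall>k\<in>{k. \<not> g k < e / 4} - {0}. dist (f s k) (f t k) < e / 2"
      by (intro eventually_ball_finite) (use fin in auto)
    moreover have "\<forall>\<^sub>F s in at t within T. s \<in> S"
      using g(1,2) topological_tendstoD tendsto_ident_at by blast
    ultimately have "\<forall>\<^sub>F s in at t within T. s \<in> S \<and>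
        (\<forall>k\<in>{k. \<not> g k < e / 4} - {0}. dist (f s k) (f t k) < e / 2)"
      by eventually_elim auto
    then obtain V where V: "open V" "t \<in> V" and
      VS: "\<forall>s\<in>V. s \<noteq> t \<longrightarrow> s \<in> T \<longrightarrow> s \<in> S \<and>
        (\<forall>k\<in>{k. \<not> g k < e / 4} - {0}. dist (f s k) (f t k) < e / 2)"
      unfolding eventually_at_topological by (elim exE conjE) (rule that)
    have "r s \<in> L.mball (r t) e" if s: "s \<in> V \<inter> T" for s
    proof (cases "s = t")
      case True
      then show ?thesis using mem t e by simp
    next
      case False
      have *: "dist (r t k) (r s k) \<le> e / 2" if k: "k \<in> ?S" for k
      proof (cases "g k < e / 4")
        case True
        have "norm (f s k) \<le> g k" "norm (f t k) \<le> g k"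
          using bound g(2) VS s t k False by auto
        then have "dist (f t k) (f s k) \<le> e / 2"
          using True norm_triangle_ineq4 [of "f t k" "f s k"] by (simp add: dist_norm)
        then show ?thesis using k by (simp add: r_def)
      next
        case False
        then show ?thesis
          using VS s k \<open>s \<noteq> t\<close> by (auto simp: r_def dist_commute intro: less_imp_le)
      qed
      have "(SUP k\<in>?S. dist (r t k) (r s k)) \<le> e / 2"
        by (rule cSUP_least [OF ne *])
      then have "Met_TC.fdist ?S (r t) (r s) \<le> e / 2"
        unfolding Met_TC.fdist_def using e by simp
      then show ?thesis using mem s t e by simp
    qed
    moreover have "openin (top_of_set T) (V \<inter> T)"
      using V by (metis Int_commute openin_open)
    ultimately show ?thesis
      using V(2) t by (intro exI [of _ "V \<inter> T"]) simp
  qed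
  then show ?thesis
    unfolding continuous_into_Linf_def top L.continuous_map_to_metric
    by (simp add: r_def)
qed

subsection \<open>Duhamel integrals\<close>

text \<open>Turns the heat factor at a positive time into the decay |k|^(-2).\<close>

lemma exp_minus_le_inverse:
  fixes x :: real
  assumes "0 < x"
  shows "exp (- x) \<le> 1 / x"
proof -
  have "x \<le> exp x"
    using exp_ge_add_one_self [of x] by linarith
  then show ?thesis
    using assms by (simp add: exp_minus inverse_eq_divide frac_le)
qed

text \<open>The bound does not depend on \<open>t\<close>; this is what makes the fixed point
  argument global in time.\<close>

lemma integral_exp_le:
  fixes \<kappa> t :: real
  assumes "0 < \<kappa>" "0 \<le> t"
  shows "integral {0..t} (\<lambda>s. exp (- (t - s) * \<kappa>)) \<le> 1 / \<kappa>"
proof -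
  have "((\<lambda>s. exp (- (t - s) * \<kappa>)) has_integral
      exp (- (t - t) * \<kappa>) / \<kappa> - exp (- (t - 0) * \<kappa>) / \<kappa>) {0..t}"
    by (rule fundamental_theorem_of_calculus)
      (use assms in \<open>auto intro!: derivative_eq_intros simp flip: has_real_derivative_iff_has_vector_derivative\<close>)
  then show ?thesis
    using assms by (auto dest!: integral_unique simp: divide_right_mono)
qed

lemma duhamel_norm_le:
  fixes g :: "real \<Rightarrow> 'a::euclidean_space"
  assumes "continuous_on {0..t} g" "\<And>s. norm (g s) \<le> B" "0 < \<kappa>" "0 \<le> t"
  shows "norm (integral {0..t} (\<lambda>s. exp (- (t - s) * \<kappa>) *\<^sub>R g s)) \<le> B / \<kappa>"
proof -
  have B: "0 \<le> B"
    using assms(2) norm_ge_zero order_trans by blast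
  have "norm (integral {0..t} (\<lambda>s. exp (- (t - s) * \<kappa>) *\<^sub>R g s))
      \<le> integral {0..t} (\<lambda>s. B * exp (- (t - s) * \<kappa>))"
    by (rule integral_norm_bound_integral)
      (use assms B in \<open>auto intro!: integrable_continuous_interval continuous_intros
        simp: mult.commute [of B] mult_left_mono\<close>)
  also have "\<dots> \<le> B * (1 / \<kappa>)"
    using integral_exp_le [OF assms(3,4)] B by (simp only: integral_mult_right mult_left_mono)
  finally show ?thesis by simp
qed

text \<open>The variable \<open>t\<close> occurs in the limit and in the integrand. Factoring out
  exp(-t \<kappa>) leaves an indefinite integral whose integrand is independent of
  \<open>t\<close>.\<close>

lemma duhamel_continuous:
  fixes g :: "real \<Rightarrow> 'a::euclidean_space"
  assumes "continuous_on {0..} g"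
  shows "continuous_on {0..} (\<lambda>t. integral {0..t} (\<lambda>s. exp (- (t - s) * \<kappa>) *\<^sub>R g s))"
proof -
  let ?I = "\<lambda>t. integral {0..t} (\<lambda>s. exp (s * \<kappa>) *\<^sub>R g s)"
  have eq: "integral {0..t} (\<lambda>s. exp (- (t - s) * \<kappa>) *\<^sub>R g s) = exp (- t * \<kappa>) *\<^sub>R ?I t" for t
  proof -
    have "exp (- (t - s) * \<kappa>) *\<^sub>R g s = exp (- t * \<kappa>) *\<^sub>R (exp (s * \<kappa>) *\<^sub>R g s)" for s
      by (simp add: algebra_simps flip: exp_add)
    then show ?thesis
      by (simp only: integral_cmul)
  qed
  have I: "continuous_on {0..b} ?I" for b
    by (intro indefinite_integral_continuous_1 integrable_continuous_interval continuous_intros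
        continuous_on_subset [OF assms]) auto
  have "continuous_on {0..} ?I"
    unfolding continuous_on_eq_continuous_within
  proof
    fix t :: real assume t: "t \<in> {0..}"
    \<comment> \<open>Continuity is local, so compact intervals reaching beyond \<open>t\<close>
      suffice.\<close>
    have "at t within {0..} = at t within {0..t + 1}"
      by (rule at_within_nhd [of _ "{..<t + 1}"]) auto
    moreover have "continuous (at t within {0..t + 1}) ?I"
      using I [of "t + 1"] t by (simp add: continuous_on_eq_continuous_within)
    ultimately show "continuous (at t within {0..}) ?I"
      by simp
  qed
  then show ?thesis
    unfolding eq by (intro continuous_intros)
qed

subsection \<open>Bounded continuous functions of time and frequency\<close>

lemma open_freq_singleton: "open {k :: freq}"
proof -
  have "{k} = (\<Inter>j. {l. l $ j \<in> {k $ j}})"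
    by (auto simp: vec_eq_iff)
  also have "open \<dots>"
    by (intro open_INT ballI open_vimage_vec_nth [unfolded vimage_def] open_discrete) auto
  finally show ?thesis .
qed

text \<open>Frequencies are discrete, so the slices with fixed frequency are open and cover the
  domain; continuity can be checked on each of them.\<close>

lemma continuous_on_time_freq:
  fixes f :: "real \<times> freq \<Rightarrow> 'a::topological_space"
  assumes "\<And>k. continuous_on UNIV (\<lambda>t. f (t, k))"
  shows "continuous_on UNIV f"
proof -
  have "continuous_on (UNIV \<times> {k}) f" for k
  proof -
    have "continuous_on (UNIV \<times> {k}) (\<lambda>x. f (fst x, k))"
      by (rule continuous_on_compose2 [OF assms]) (auto intro: continuous_intros)
    then show ?thesis
      by (rule continuous_on_eq) auto
  qed
  then have "continuous_on (\<Union>k. UNIV \<times> {k}) f"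
    by (intro continuous_on_open_UN open_Times open_UNIV open_freq_singleton) auto
  moreover have "(\<Union>k :: freq. (UNIV :: real set) \<times> {k}) = UNIV"
    by auto
  ultimately show ?thesis by simp
qed

lemma continuous_on_advection:
  assumes "\<And>l. continuous_on S (\<lambda>s. u s l)"
  shows "continuous_on S (\<lambda>s. advection (u s) (u s) k l)"
proof -
  have "continuous_on S (\<lambda>s. pairing k (u s (k - l)))" "continuous_on S (\<lambda>s. leray k (u s l))"
    by (intro bounded_linear.continuous_on [OF bounded_linear_pairing] assms
        bounded_linear.continuous_on [OF bounded_linear_leray])+
  then show ?thesis
    unfolding advection_def vector_scalar_mult_def
    by (intro continuous_on_vec_lambda continuous_intros)
qed

text \<open>The library has this for metric domains only; \<open>real \<times> freq\<close> carries no metric instance.\<close>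

lemma complete_UNIV_bcontfun:
  "complete (UNIV :: ('a::topological_space \<Rightarrow>\<^sub>C 'b::complete_space) set)"
proof (rule completeI)
  fix f :: "nat \<Rightarrow> 'a \<Rightarrow>\<^sub>C 'b"
  assume "Cauchy f"
  have "uniformly_Cauchy_on UNIV (\<lambda>n. apply_bcontfun (f n))"
    unfolding uniformly_Cauchy_on_def
    using metric_CauchyD [OF \<open>Cauchy f\<close>] by (meson dist_fun_lt_imp_dist_val_lt)
  then obtain g where "uniform_limit UNIV (\<lambda>n. apply_bcontfun (f n)) g sequentially"
    using Cauchy_uniformly_convergent uniformly_convergent_on_def by blast
  then obtain l where "f \<longlonglongrightarrow> l"
    using uniform_limit_bcontfunE [OF _ sequentially_bot] by metis
  then show "\<exists>l\<in>UNIV. f \<longlonglongrightarrow> l"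
    by blast
qed

subsection \<open>The fixed point\<close>

text \<open>Only these facts about the exponents enter the fixed point argument. The inequality
  \<alpha> < 1 + \<beta> leaves the rescaled Duhamel term with the positive decay exponent 1 +
  \<beta> - \<alpha>.\<close>

locale convolution_decay =
  fixes \<alpha> \<beta> C :: real
  assumes C_pos: "0 < C"
    and decay: "\<alpha> < 1 + \<beta>"
    and conv_summable: "\<And>k. (\<lambda>l. znorm (k - l) powr - \<alpha> * znorm l powr - \<alpha>) summable_on UNIV"
    and conv_le: "\<And>k. k \<noteq> 0 \<Longrightarrow>
      (\<Sum>\<^sub>\<infinity>l. znorm (k - l) powr - \<alpha> * znorm l powr - \<alpha>) \<le> C * znorm k powr - \<beta>"
begin

text \<open>As \<open>W 0\<close> is 0, a bound of \<open>norm (u l)\<close> by a multiple of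
  \<open>W l\<close> for all \<open>l\<close> includes that \<open>u\<close> vanishes at frequency
  0.\<close>

definition W :: "freq \<Rightarrow> real" where "W k = znorm k powr - \<alpha>"

lemma W_0 [simp]: "W 0 = 0" and W_nonneg [simp]: "0 \<le> W k"
  by (simp_all add: W_def)

lemma powr_W: "k \<noteq> 0 \<Longrightarrow> znorm k powr \<alpha> * W k = 1"
  by (simp add: W_def flip: powr_add)

section \<open>Weighted estimates for the convolution sum\<close>

lemma norm_advection_W_le:
  assumes "\<And>l. norm (u l) \<le> a * W l" "\<And>l. norm (w l) \<le> b * W l"
  shows "norm (advection u w k l) \<le> 2 * znorm k * a * b * (W (k - l) * W l)"
  using norm_advection_le [of u k l, OF assms] by (simp add: mult_ac)

lemma W_conv_summable: "(\<lambda>l. c * (W (k - l) * W l)) summable_on UNIV"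
  unfolding W_def by (intro summable_on_cmult_right conv_summable)

lemma advection_summable:
  assumes "\<And>l. norm (u l) \<le> a * W l" "\<And>l. norm (w l) \<le> b * W l"
  shows "(\<lambda>l. norm (advection u w k l)) summable_on UNIV" "advection u w k summable_on UNIV"
proof -
  show "(\<lambda>l. norm (advection u w k l)) summable_on UNIV"
    by (rule Infinite_Sum.abs_summable_on_comparison_test' [OF W_conv_summable])
      (rule norm_advection_W_le [OF assms])
  then show "advection u w k summable_on UNIV"
    by (rule Infinite_Sum.abs_summable_summable)
qed

lemma norm_advection_sum_le:
  assumes "\<And>l. norm (u l) \<le> a * W l" "\<And>l. norm (w l) \<le> b * W l" "0 \<le> a" "0 \<le> b" "k \<noteq> 0"
  shows "norm (\<Sum>\<^sub>\<infinity>l. advection u w k l) \<le> 2 * C * a * b * znorm k powr (1 - \<beta>)"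
proof -
  have "norm (\<Sum>\<^sub>\<infinity>l. advection u w k l) \<le> (\<Sum>\<^sub>\<infinity>l. 2 * znorm k * a * b * (W (k - l) * W l))"
    by (rule norm_infsum_le [OF has_sum_infsum has_sum_infsum])
      (use advection_summable(2) [OF assms(1,2)] W_conv_summable norm_advection_W_le [OF assms(1,2)] in auto)
  also have "\<dots> = 2 * znorm k * a * b * (\<Sum>\<^sub>\<infinity>l. W (k - l) * W l)"
    by (rule infsum_cmult_right')
  also have "\<dots> \<le> 2 * znorm k * a * b * (C * znorm k powr - \<beta>)"
    unfolding W_def by (intro mult_left_mono conv_le) (use assms in auto)
  also have "\<dots> = 2 * C * a * b * znorm k powr (1 - \<beta>)"
    using znorm_ge_1 [OF assms(5)] by (simp add: powr_diff powr_minus divide_simps)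
  finally show ?thesis .
qed

lemma norm_advection_sum_diff_le:
  assumes u: "\<And>l. norm (u l) \<le> r * W l" and w: "\<And>l. norm (w l) \<le> r * W l"
    and uw: "\<And>l. norm (u l - w l) \<le> d * W l" and "0 \<le> r" "0 \<le> d" "k \<noteq> 0"
  shows "norm ((\<Sum>\<^sub>\<infinity>l. advection u u k l) - (\<Sum>\<^sub>\<infinity>l. advection w w k l))
    \<le> 4 * C * r * d * znorm k powr (1 - \<beta>)"
proof -
  have uw': "norm ((u - w) l) \<le> d * W l" for l
    using uw by simp
  have "(\<Sum>\<^sub>\<infinity>l. advection u u k l)
      = (\<Sum>\<^sub>\<infinity>l. (advection (u - w) u k l + advection w (u - w) k l) + advection w w k l)"
    by (simp flip: advection_diff)
  also have "\<dots> = ((\<Sum>\<^sub>\<infinity>l. advection (u - w) u k l) + (\<Sum>\<^sub>\<infinity>l. advection w (u - w) k l))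
      + (\<Sum>\<^sub>\<infinity>l. advection w w k l)"
    by (simp only: infsum_add summable_on_add advection_summable(2) [OF w w]
        advection_summable(2) [OF uw' u] advection_summable(2) [OF w uw'])
  finally have "norm ((\<Sum>\<^sub>\<infinity>l. advection u u k l) - (\<Sum>\<^sub>\<infinity>l. advection w w k l))
      = norm ((\<Sum>\<^sub>\<infinity>l. advection (u - w) u k l) + (\<Sum>\<^sub>\<infinity>l. advection w (u - w) k l))"
    by simp
  also have "\<dots> \<le> 2 * C * d * r * znorm k powr (1 - \<beta>) + 2 * C * r * d * znorm k powr (1 - \<beta>)"
    by (intro norm_triangle_mono norm_advection_sum_le u w uw' assms)
  finally show ?thesis by (simp add: mult_ac)
qed

text \<open>Weierstrass M-test: the summable majorant does not depend on \<open>s\<close>, so the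
  finite partial sums converge uniformly.\<close>

lemma continuous_on_advection_sum:
  assumes "\<And>s l. norm (u s l) \<le> r * W l" "\<And>l. continuous_on S (\<lambda>s. u s l)"
  shows "continuous_on S (\<lambda>s. \<Sum>\<^sub>\<infinity>l. advection (u s) (u s) k l)"
proof (rule uniform_limit_theorem)
  show "uniform_limit S (\<lambda>X s. \<Sum>l\<in>X. advection (u s) (u s) k l)
      (\<lambda>s. \<Sum>\<^sub>\<infinity>l. advection (u s) (u s) k l) (finite_subsets_at_top UNIV)"
    by (rule Weierstrass_m_test_general [OF _ W_conv_summable]) (rule norm_advection_W_le [OF assms(1) assms(1)])
  show "\<forall>\<^sub>F X in finite_subsets_at_top UNIV. continuous_on S (\<lambda>s. \<Sum>l\<in>X. advection (u s) (u s) k l)"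
    by (intro always_eventually allI continuous_on_sum continuous_on_advection assms)
qed auto

text \<open>The Duhamel term on the scale of the coefficients \<open>c\<close>, hence the weight
  |k|^\<alpha>. It is written with the gauge integral and identified with the Lebesgue integral of
  \<open>ns_solution\<close> in the final proof.\<close>

definition nonlinear :: "(real \<Rightarrow> field) \<Rightarrow> real \<Rightarrow> field" where
  "nonlinear u t k = znorm k powr \<alpha> *\<^sub>R ((2 * of_real pi * \<i>) *s
     integral {0..t} (\<lambda>s. exp (- (t - s) * (znorm k)\<^sup>2) *\<^sub>R (\<Sum>\<^sub>\<infinity>l. advection (u s) (u s) k l)))"

text \<open>Counting powers of |k|: \<alpha> from the weight, 1 - \<beta> from \<open>g\<close>, and
  -2 from the time integral of the heat kernel. The function \<open>g\<close> is general so that the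
  bound also applies to differences.\<close>

lemma weighted_duhamel_norm_le:
  fixes g :: "real \<Rightarrow> complex^3"
  assumes "continuous_on {0..t} g" "\<And>s. norm (g s) \<le> B * znorm k powr (1 - \<beta>)" "0 \<le> t" "k \<noteq> 0"
  shows "norm (znorm k powr \<alpha> *\<^sub>R ((2 * of_real pi * \<i>) *s
     integral {0..t} (\<lambda>s. exp (- (t - s) * (znorm k)\<^sup>2) *\<^sub>R g s))) \<le> 2 * pi * B * znorm k powr - (1 + \<beta> - \<alpha>)"
proof -
  have k: "0 < znorm k"
    using znorm_ge_1 [OF assms(4)] by simp
  have "norm (integral {0..t} (\<lambda>s. exp (- (t - s) * (znorm k)\<^sup>2) *\<^sub>R g s))
      \<le> B * znorm k powr (1 - \<beta>) / (znorm k)\<^sup>2"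
    by (rule duhamel_norm_le) (use assms k in auto)
  then have "znorm k powr \<alpha> * (2 * pi * norm (integral {0..t} (\<lambda>s. exp (- (t - s) * (znorm k)\<^sup>2) *\<^sub>R g s)))
      \<le> znorm k powr \<alpha> * (2 * pi * (B * znorm k powr (1 - \<beta>) / (znorm k)\<^sup>2))"
    by (intro mult_left_mono) auto
  also have "\<dots> = 2 * pi * B * (znorm k powr \<alpha> * znorm k powr (1 - \<beta>) * znorm k powr - 2)"
    using k by (simp add: powr_minus powr_realpow divide_simps)
  also have "\<dots> = 2 * pi * B * znorm k powr - (1 + \<beta> - \<alpha>)"
    by (simp add: algebra_simps flip: powr_add)
  finally show ?thesis
    by (simp add: norm_smult_complex norm_mult)
qed

section \<open>Size, Lipschitz and continuity estimates for the Duhamel term\<close>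

lemma norm_nonlinear_le:
  assumes "\<And>s l. norm (u s l) \<le> r * W l" "\<And>l. continuous_on UNIV (\<lambda>s. u s l)"
    "0 \<le> r" "0 \<le> t" "k \<noteq> 0"
  shows "norm (nonlinear u t k) \<le> 4 * pi * C * r\<^sup>2 * znorm k powr - (1 + \<beta> - \<alpha>)"
proof -
  have "norm (\<Sum>\<^sub>\<infinity>l. advection (u s) (u s) k l) \<le> (2 * C * r * r) * znorm k powr (1 - \<beta>)" for s
    by (intro norm_advection_sum_le assms)
  moreover have "continuous_on {0..t} (\<lambda>s. \<Sum>\<^sub>\<infinity>l. advection (u s) (u s) k l)"
    by (intro continuous_on_advection_sum [OF assms(1)] continuous_on_subset [OF assms(2)]) auto
  ultimately have "norm (nonlinear u t k) \<le> 2 * pi * (2 * C * r * r) * znorm k powr - (1 + \<beta> - \<alpha>)"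
    unfolding nonlinear_def using assms by (intro weighted_duhamel_norm_le)
  then show ?thesis
    by (simp add: power2_eq_square mult_ac)
qed

lemma norm_nonlinear_diff_le:
  assumes u: "\<And>s l. norm (u s l) \<le> r * W l" "\<And>l. continuous_on UNIV (\<lambda>s. u s l)"
    and w: "\<And>s l. norm (w s l) \<le> r * W l" "\<And>l. continuous_on UNIV (\<lambda>s. w s l)"
    and uw: "\<And>s l. norm (u s l - w s l) \<le> d * W l"
    and "0 \<le> r" "0 \<le> d" "0 \<le> t" "k \<noteq> 0"
  shows "norm (nonlinear u t k - nonlinear w t k) \<le> 8 * pi * C * r * d * znorm k powr - (1 + \<beta> - \<alpha>)"
proof -
  let ?N = "\<lambda>u s. \<Sum>\<^sub>\<infinity>l. advection (u s) (u s) k l"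
  have c: "continuous_on {0..t} (?N u)" "continuous_on {0..t} (?N w)"
    by (intro continuous_on_advection_sum [OF u(1)] continuous_on_advection_sum [OF w(1)]
        continuous_on_subset [OF u(2)] continuous_on_subset [OF w(2)]; simp)+
  have "norm (?N u s - ?N w s) \<le> (4 * C * r * d) * znorm k powr (1 - \<beta>)" for s
    by (intro norm_advection_sum_diff_le assms)
  then have "norm (znorm k powr \<alpha> *\<^sub>R ((2 * of_real pi * \<i>) *s
     integral {0..t} (\<lambda>s. exp (- (t - s) * (znorm k)\<^sup>2) *\<^sub>R (?N u s - ?N w s))))
      \<le> 2 * pi * (4 * C * r * d) * znorm k powr - (1 + \<beta> - \<alpha>)"
    using assms c by (intro weighted_duhamel_norm_le continuous_on_diff)
  moreover have "integral {0..t} (\<lambda>s. exp (- (t - s) * (znorm k)\<^sup>2) *\<^sub>R (?N u s - ?N w s))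
    = integral {0..t} (\<lambda>s. exp (- (t - s) * (znorm k)\<^sup>2) *\<^sub>R ?N u s)
      - integral {0..t} (\<lambda>s. exp (- (t - s) * (znorm k)\<^sup>2) *\<^sub>R ?N w s)"
    unfolding scaleR_diff_right
    by (intro integral_diff integrable_continuous_interval continuous_intros c)
  ultimately have "norm (nonlinear u t k - nonlinear w t k)
      \<le> 2 * pi * (4 * C * r * d) * znorm k powr - (1 + \<beta> - \<alpha>)"
    by (simp only: nonlinear_def vector_ssub_ldistrib scaleR_diff_right [of "znorm k powr \<alpha>"])
  then show ?thesis
    by (simp add: mult_ac)
qed

lemma continuous_on_nonlinear:
  assumes "\<And>s l. norm (u s l) \<le> r * W l" "\<And>l. continuous_on UNIV (\<lambda>s. u s l)"
  shows "continuous_on {0..} (\<lambda>t. nonlinear u t k)"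
proof -
  have "continuous_on {0..} (\<lambda>t. integral {0..t} (\<lambda>s. exp (- (t - s) * (znorm k)\<^sup>2) *\<^sub>R
      (\<Sum>\<^sub>\<infinity>l. advection (u s) (u s) k l)))"
    by (intro duhamel_continuous continuous_on_advection_sum [OF assms(1)] continuous_on_subset [OF assms(2)]) auto
  then show ?thesis
    unfolding nonlinear_def vector_scalar_mult_def
    by (intro continuous_intros continuous_on_vec_lambda)
qed

text \<open>Banach's fixed point theorem on the ball of radius \<open>r\<close>. The heat flow uses
  up r/2 and the Duhamel term at most r/4, while the Lipschitz constant 8 pi C r is at most
  1/2.\<close>

lemma mild_solution_exists:
  fixes v\<^sub>0 :: field
  assumes r: "0 \<le> r" "16 * pi * C * r \<le> 1" and v0: "\<And>k. norm (v\<^sub>0 k) \<le> r / 2 * W k"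
  obtains u :: "real \<Rightarrow> field"
  where "\<And>s l. norm (u s l) \<le> r * W l" "\<And>l. continuous_on UNIV (\<lambda>s. u s l)"
    "\<And>t k. 0 \<le> t \<Longrightarrow> k \<noteq> 0 \<Longrightarrow> u t k = heat t v\<^sub>0 k + W k *\<^sub>R nonlinear u t k"
proof -
  \<comment> \<open>The unknown \<open>x\<close> is the velocity times |k|^\<alpha>, so bounds in
    the weighted norm become bounds in the supremum norm; \<open>vel\<close> removes the
    weight.\<close>
  define vel :: "((real \<times> freq) \<Rightarrow>\<^sub>C (complex^3)) \<Rightarrow> real \<Rightarrow> field"
    where "vel x t k = W k *\<^sub>R x (t, k)" for x t k
  \<comment> \<open>\<open>max t 0\<close> extends the map to negative times by its value at 0, so
    that the domain is the whole type.\<close>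
  define F where "F x = (\<lambda>(t, k). if k = 0 then 0 else
    znorm k powr \<alpha> *\<^sub>R heat (max t 0) v\<^sub>0 k + nonlinear (vel x) (max t 0) k)" for x
  have vel_cont: "continuous_on UNIV (\<lambda>s. vel x s l)" for x l
    unfolding vel_def
    by (intro continuous_intros continuous_on_compose2 [OF continuous_on_apply_bcontfun]) auto
  have vel_le: "norm (vel x s l) \<le> r * W l" if "norm x \<le> r" for x s l
    using mult_right_mono [OF order_trans [OF norm_bounded that] W_nonneg] by (simp add: vel_def mult.commute)
  \<comment> \<open>For the contraction the decay in frequency is discarded; it is needed only for
    continuity into \<open>Linf\<close>.\<close>
  have decay_le: "znorm k powr - (1 + \<beta> - \<alpha>) \<le> 1" if "k \<noteq> 0" for k
    using powr_mono [of "- (1 + \<beta> - \<alpha>)" 0 "znorm k"] znorm_ge_1 [OF that] decay that by simp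
  have F_le: "norm (F x y) \<le> r" if x: "norm x \<le> r" for x y
  proof (cases y)
    case (Pair t k)
    show ?thesis
    proof (cases "k = 0")
      case True
      then show ?thesis using r by (simp add: F_def Pair)
    next
      case False
      have "exp (- max t 0 * (znorm k)\<^sup>2) * norm (v\<^sub>0 k) \<le> 1 * (r / 2 * W k)"
        by (intro mult_mono v0) auto
      then have "znorm k powr \<alpha> * norm (heat (max t 0) v\<^sub>0 k) \<le> znorm k powr \<alpha> * (r / 2 * W k)"
        by (intro mult_left_mono) (auto simp: heat_def)
      also have "\<dots> = r / 2 * (znorm k powr \<alpha> * W k)"
        by simp
      finally have 1: "norm (znorm k powr \<alpha> *\<^sub>R heat (max t 0) v\<^sub>0 k) \<le> r / 2"
        by (simp add: powr_W [OF False])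
      have "norm (nonlinear (vel x) (max t 0) k) \<le> 4 * pi * C * r\<^sup>2 * znorm k powr - (1 + \<beta> - \<alpha>)"
        by (rule norm_nonlinear_le [OF vel_le [OF x] vel_cont]) (use r False in auto)
      also have "\<dots> \<le> 4 * pi * C * r\<^sup>2 * 1"
        by (intro mult_left_mono decay_le False) (use C_pos in auto)
      also have "\<dots> = (16 * pi * C * r) * (r / 4)"
        by (simp add: power2_eq_square)
      also have "\<dots> \<le> 1 * (r / 4)"
        by (rule mult_right_mono) (use r in auto)
      finally have 2: "norm (nonlinear (vel x) (max t 0) k) \<le> r / 4"
        by simp
      show ?thesis
        using norm_triangle_mono [OF 1 2] r False by (simp add: F_def Pair)
    qed
  qed
  have F_bc: "F x \<in> bcontfun" if x: "norm x \<le> r" for x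
  proof (rule bcontfun_normI [OF continuous_on_time_freq F_le [OF x]])
    fix k
    have "continuous_on UNIV (\<lambda>t. nonlinear (vel x) (max t 0) k)"
      by (rule continuous_on_compose2 [OF continuous_on_nonlinear [OF vel_le [OF x] vel_cont]])
        (auto intro!: continuous_intros)
    then show "continuous_on UNIV (\<lambda>t. F x (t, k))"
      unfolding F_def heat_def by (cases "k = 0") (auto intro!: continuous_intros)
  qed
  \<comment> \<open>\<open>F x\<close> is shown to be bounded and continuous only for
    \<open>x\<close> in the ball, so \<open>T\<close> is evaluated only there.\<close>
  define T where "T x = Bcontfun (F x)" for x
  have T: "apply_bcontfun (T x) = F x" if "norm x \<le> r" for x
    unfolding T_def by (rule Bcontfun_inverse [OF F_bc [OF that]])
  have "\<exists>!x\<in>cball 0 r. T x = x"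
  proof (rule Banach_fix [where c = "1 / 2"])
    show "T ` cball 0 r \<subseteq> cball 0 r"
      using F_le by (auto intro!: norm_bound simp: T)
    show "dist (T x) (T y) \<le> 1 / 2 * dist x y" if "x \<in> cball 0 r" "y \<in> cball 0 r" for x y
    proof -
      have x: "norm x \<le> r" and y: "norm y \<le> r"
        using that by auto
      have diff: "norm (vel x s l - vel y s l) \<le> dist x y * W l" for s l
        using mult_right_mono [OF dist_bounded [of x "(s, l)" y] W_nonneg [of l]]
        by (simp add: vel_def dist_norm mult.commute flip: scaleR_diff_right)
      have "dist (F x z) (F y z) \<le> 1 / 2 * dist x y" for z
      proof (cases z)
        case (Pair t k)
        show ?thesis
        proof (cases "k = 0")
          case True
          then show ?thesis by (simp add: F_def Pair)
        next
          case False
          have "norm (nonlinear (vel x) (max t 0) k - nonlinear (vel y) (max t 0) k)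
              \<le> 8 * pi * C * r * dist x y * znorm k powr - (1 + \<beta> - \<alpha>)"
            by (rule norm_nonlinear_diff_le [OF vel_le [OF x] vel_cont vel_le [OF y] vel_cont diff])
              (use r False in auto)
          also have "\<dots> \<le> 8 * pi * C * r * dist x y * 1"
            by (intro mult_left_mono decay_le False) (use C_pos r in auto)
          also have "\<dots> = (16 * pi * C * r) * (dist x y / 2)"
            by simp
          also have "\<dots> \<le> 1 * (dist x y / 2)"
            by (rule mult_right_mono) (use r in auto)
          finally show ?thesis
            using False by (simp add: F_def Pair dist_norm)
        qed
      qed
      then show ?thesis
        by (intro dist_bound) (simp add: T x y)
    qed
  qed (use r in \<open>auto intro: complete_closed_subset [OF closed_cball subset_UNIV complete_UNIV_bcontfun]\<close>)
  then obtain x where x: "norm x \<le> r" "T x = x"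
    by auto
  have fix_eq: "vel x t k = heat t v\<^sub>0 k + W k *\<^sub>R nonlinear (vel x) t k" if "0 \<le> t" "k \<noteq> 0" for t k
  proof -
    have "apply_bcontfun x (t, k) = F x (t, k)"
      using T [OF x(1)] x(2) by metis
    then show ?thesis
      using that powr_W [OF that(2)] by (simp add: vel_def F_def max_absorb1 scaleR_add_right mult.commute)
  qed
  show ?thesis
    by (rule that [OF vel_le [OF x(1)] vel_cont fix_eq])
qed

end

text \<open>Continuity is stated in three forms because the heat flow of a bounded
  \<open>c\<^sub>0\<close> that does not vanish at infinity is discontinuous at t = 0 in the
  supremum norm. Away from t = 0, or after subtraction of the heat flow, the obstruction
  disappears.\<close>

theorem theorem1:
  fixes \<epsilon> \<alpha> :: real
  assumes "0 < 3 * \<epsilon>" and "3 * \<epsilon> < 1" and "\<alpha> = 2 + \<epsilon>"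
  shows "\<exists>\<delta>>0. \<forall>(v\<^sub>0 :: field) (c\<^sub>0 :: field).
    v\<^sub>0 0 = 0 \<longrightarrow>
    (\<forall>k. k \<noteq> 0 \<longrightarrow> pairing k (v\<^sub>0 k) = 0) \<longrightarrow>
    (\<forall>k. k \<noteq> 0 \<longrightarrow> v\<^sub>0 k = c\<^sub>0 k /\<^sub>R znorm k powr \<alpha>) \<longrightarrow>
    v\<^sub>0 \<in> Phi \<alpha> \<longrightarrow>
    Phi_norm \<alpha> v\<^sub>0 \<le> \<delta> \<longrightarrow>
    (\<exists>v c. ns_solution v\<^sub>0 v \<and>
       (\<forall>t\<ge>0. \<forall>k. k \<noteq> 0 \<longrightarrow> v t k = c t k /\<^sub>R znorm k powr \<alpha>) \<and>
       continuous_into_Linf {0<..} c \<and>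
       continuous_into_Linf {0..} (\<lambda>t k. c t k - heat t c\<^sub>0 k) \<and>
       ((c\<^sub>0 \<longlongrightarrow> 0) cofinite \<longrightarrow> continuous_into_Linf {0..} c))"
proof -
  \<comment> \<open>Summability needs \<beta> < 2\<alpha> - 3 = 1 + 2\<epsilon> and decay needs
    \<beta> > \<alpha> - 1 = 1 + \<epsilon>; this is the midpoint.\<close>
  define \<beta> where "\<beta> = 1 + 3 / 2 * \<epsilon>"
  have exponents: "3 < 2 * \<alpha> - \<beta>" "0 \<le> \<beta>" "\<beta> \<le> \<alpha>"
    using assms by (auto simp: \<beta>_def)
  obtain C where C: "0 < C"
    "\<And>k. (\<lambda>l. znorm (k - l) powr - \<alpha> * znorm l powr - \<alpha>) summable_on UNIV"
    "\<And>k. k \<noteq> 0 \<Longrightarrow> (\<Sum>\<^sub>\<infinity>l. znorm (k - l) powr - \<alpha> * znorm l powr - \<alpha>) \<le> C * znorm k powr - \<beta>"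
    by (rule convolution_bound [OF exponents]) (rule that)
  interpret convolution_decay \<alpha> \<beta> C
    by unfold_locales (use C assms in \<open>auto simp: \<beta>_def\<close>)
  \<comment> \<open>The largest radius allowed by the contraction; \<delta> = r/2 leaves the other
    half of the ball to the Duhamel term.\<close>
  define r where "r = 1 / (16 * pi * C)"
  have r: "0 < r" "16 * pi * C * r \<le> 1"
    using C(1) by (auto simp: r_def)
  show ?thesis
  proof (intro exI [of _ "r / 2"] conjI allI impI)
    show "0 < r / 2" using r by simp
    fix v\<^sub>0 c\<^sub>0 :: field
    assume v0_0: "v\<^sub>0 0 = 0" and v0_perp: "\<forall>k. k \<noteq> 0 \<longrightarrow> pairing k (v\<^sub>0 k) = 0"
      and v0_c0: "\<forall>k. k \<noteq> 0 \<longrightarrow> v\<^sub>0 k = c\<^sub>0 k /\<^sub>R znorm k powr \<alpha>"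
      and Phi: "v\<^sub>0 \<in> Phi \<alpha>" and small: "Phi_norm \<alpha> v\<^sub>0 \<le> r / 2"
    have W_eq: "W k = inverse (znorm k powr \<alpha>)" for k
      by (simp add: W_def powr_minus)
    have v0W: "v\<^sub>0 k = W k *\<^sub>R c\<^sub>0 k" if "k \<noteq> 0" for k
      using v0_c0 that by (simp add: W_eq)
    \<comment> \<open>Membership in \<open>Phi \<alpha>\<close> makes the set under the supremum
      bounded above, so that \<open>Phi_norm\<close> really dominates each term.\<close>
    have c0: "norm (c\<^sub>0 k) \<le> r / 2" if k: "k \<noteq> 0" for k
    proof -
      obtain c where c: "bounded (c ` (- {0}))" "\<And>k. k \<noteq> 0 \<Longrightarrow> v\<^sub>0 k = c k /\<^sub>R znorm k powr \<alpha>"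
        using Phi by (auto simp: Phi_def)
      have eq: "znorm k powr \<alpha> * norm (v\<^sub>0 k) = norm (c k)" if "k \<noteq> 0" for k
        using c(2) [OF that] that by simp
      obtain B where "\<And>k. k \<noteq> 0 \<Longrightarrow> norm (c k) \<le> B"
        using c(1) by (auto simp: bounded_iff)
      then have "bdd_above ((\<lambda>k. znorm k powr \<alpha> * norm (v\<^sub>0 k)) ` (- {0}))"
        using eq by (intro bdd_aboveI2 [of _ _ B]) auto
      then have "znorm k powr \<alpha> * norm (v\<^sub>0 k) \<le> Phi_norm \<alpha> v\<^sub>0"
        unfolding Phi_norm_def by (rule cSUP_upper2) (use k in auto)
      moreover have "znorm k powr \<alpha> * norm (v\<^sub>0 k) = norm (c\<^sub>0 k)"
        using k v0_c0 by simp
      ultimately show ?thesis using small by simp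
    qed
    have v0_le: "norm (v\<^sub>0 k) \<le> r / 2 * W k" for k
    proof (cases "k = 0")
      case False
      then show ?thesis
        using mult_right_mono [OF c0 [OF False] W_nonneg [of k]] by (simp add: v0W mult.commute)
    qed (simp add: v0_0)
    obtain u :: "real \<Rightarrow> field" where
      u: "\<And>s l. norm (u s l) \<le> r * W l" and u_cont: "\<And>l. continuous_on UNIV (\<lambda>s. u s l)" and
      u_eq: "\<And>t k. 0 \<le> t \<Longrightarrow> k \<noteq> 0 \<Longrightarrow> u t k = heat t v\<^sub>0 k + W k *\<^sub>R nonlinear u t k"
      using mild_solution_exists [OF _ r(2) v0_le] r(1) by (metis less_imp_le)
    let ?g = "\<lambda>t k s. exp (- (t - s) * (znorm k)\<^sup>2) *\<^sub>R (\<Sum>\<^sub>\<infinity>l. advection (u s) (u s) k l)"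
    have g_cont: "continuous_on {0..t} (?g t k)" for t k
      by (intro continuous_intros continuous_on_advection_sum [OF u] continuous_on_subset [OF u_cont]) auto
    have g_int: "set_integrable lborel {0..t} (?g t k)" for t k
      by (rule borel_integrable_atLeastAtMost' [OF g_cont])
    have W_nonlinear: "W k *\<^sub>R nonlinear u t k =
        (2 * of_real pi * \<i>) *s (LINT s:{0..t}|lborel. ?g t k s)" if "k \<noteq> 0" for t k
      unfolding set_borel_integral_eq_integral(2) [OF g_int] nonlinear_def
      using powr_W [OF that] by (simp add: mult.commute)
    \<comment> \<open>The heat flow inherits orthogonality from the data. In the Duhamel term every
      summand is a multiple of a Leray projection, and \<open>pairing k\<close> passes through the
      sum and the integral.\<close>
    have perp: "pairing k (u t k) = 0" if "0 \<le> t" "k \<noteq> 0" for t k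
    proof -
      have "pairing k (integral {0..t} (?g t k)) = integral {0..t} (\<lambda>s. pairing k (?g t k s))"
        using integral_linear [OF integrable_continuous_interval [OF g_cont] bounded_linear_pairing]
        by (simp add: o_def)
      also have "\<dots> = 0"
        by (simp add: linear_cmul [OF linear_pairing] pairing_infsum_eq_0 pairing_advection advection_summable(2) [OF u u])
      finally have "pairing k (W k *\<^sub>R nonlinear u t k) = 0"
        by (simp add: nonlinear_def linear_cmul [OF linear_pairing] pairing_smult)
      then show ?thesis
        using that v0_perp
        by (simp add: u_eq heat_def linear_add [OF linear_pairing] linear_cmul [OF linear_pairing])
    qed
    define c where "c t k = znorm k powr \<alpha> *\<^sub>R u t k" for t k
    have c_eq: "c t k - heat t c\<^sub>0 k = nonlinear u t k" if "0 \<le> t" "k \<noteq> 0" for t k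
    proof -
      have "heat t v\<^sub>0 k = W k *\<^sub>R heat t c\<^sub>0 k"
        using that by (simp add: heat_def v0W)
      then show ?thesis
        using that powr_W [OF that(2)] by (simp add: c_def u_eq scaleR_add_right)
    qed
    let ?d = "\<lambda>k. 4 * pi * C * r\<^sup>2 * znorm k powr - (1 + \<beta> - \<alpha>)"
    have d: "(?d \<longlongrightarrow> 0) cofinite"
      by (rule znorm_powr_tendsto_0) (use decay in simp)
    have nonlinear_le: "norm (nonlinear u t k) \<le> ?d k" if "0 \<le> t" "k \<noteq> 0" for t k
      by (rule norm_nonlinear_le [OF u u_cont]) (use r that in auto)
    have c_cont: "continuous_on UNIV (\<lambda>t. c t k)" for k
      unfolding c_def by (intro continuous_intros u_cont)
    have c_le: "norm (c t k) \<le> norm (heat t c\<^sub>0 k) + ?d k" if "0 \<le> t" "k \<noteq> 0" for t k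
      using c_eq [OF that] nonlinear_le [OF that] norm_triangle_ineq [of "heat t c\<^sub>0 k" "nonlinear u t k"]
      by (simp add: algebra_simps)
    have "ns_solution v\<^sub>0 u"
      unfolding ns_solution_def advection_def [symmetric]
    proof (intro allI impI conjI)
      fix t :: real assume t: "0 \<le> t"
      show "u t 0 = 0" using u [of t 0] by simp
      fix k :: freq assume k: "k \<noteq> 0"
      show "pairing k (u t k) = 0" by (rule perp [OF t k])
      show "advection (u t) (u t) k summable_on UNIV" by (rule advection_summable(2) [OF u u])
      show "set_integrable lborel {0..t} (?g t k)" by (rule g_int)
      show "u t k = heat t v\<^sub>0 k + (2 * of_real pi * \<i>) *s (LINT s:{0..t}|lborel. ?g t k s)"
        by (simp only: u_eq [OF t k] W_nonlinear [OF k])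
    qed
    moreover have "\<forall>t\<ge>0. \<forall>k. k \<noteq> 0 \<longrightarrow> u t k = c t k /\<^sub>R znorm k powr \<alpha>"
      by (simp add: c_def)
    moreover have "continuous_into_Linf {0<..} c"
    proof (rule continuous_map_LinfI)
      show "continuous_on {0<..} (\<lambda>t. c t k)" for k
        by (rule continuous_on_subset [OF c_cont]) simp
      fix t :: real assume t: "t \<in> {0<..}"
      \<comment> \<open>For s > t/2 the heat factor is at most 2/(t |k|^2); multiplied by the bound
        r/2 on the data this gives the first term.\<close>
      let ?h = "\<lambda>k. (r / t) * znorm k powr - 2 + ?d k"
      have "norm (c s k) \<le> ?h k" if s: "t / 2 < s" and k: "k \<noteq> 0" for s k
      proof -
        have x: "0 < s * (znorm k)\<^sup>2" "t / 2 * (znorm k)\<^sup>2 \<le> s * (znorm k)\<^sup>2"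
          using s t k by (auto intro!: mult_right_mono mult_pos_pos)
        have "exp (- s * (znorm k)\<^sup>2) \<le> 1 / (s * (znorm k)\<^sup>2)"
          using exp_minus_le_inverse [OF x(1)] by simp
        also have "\<dots> \<le> 1 / (t / 2 * (znorm k)\<^sup>2)"
          using x t k by (intro divide_left_mono mult_pos_pos) auto
        finally have "norm (heat s c\<^sub>0 k) \<le> 1 / (t / 2 * (znorm k)\<^sup>2) * (r / 2)"
          unfolding heat_def norm_scaleR using c0 [OF k] t by (intro mult_mono) auto
        also have "\<dots> = (r / t) * znorm k powr - 2"
          using k t by (simp add: powr_minus powr_realpow field_simps)
        finally show ?thesis
          using c_le [of s k] s t k by simp
      qed
      moreover have "(?h \<longlongrightarrow> 0) cofinite"
        using tendsto_add [OF znorm_powr_tendsto_0 [of 2 "r / t"] d] by simp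
      ultimately show "\<exists>S g. open S \<and> t \<in> S \<and> (g \<longlongrightarrow> 0) cofinite \<and>
          (\<forall>s\<in>S \<inter> {0<..}. \<forall>k. k \<noteq> 0 \<longrightarrow> norm (c s k) \<le> g k)"
        using t by (intro exI [of _ "{t / 2<..}"] exI [of _ ?h]) auto
    qed
    \<comment> \<open>The difference is the Duhamel term, whose majorant \<open>?d\<close> is
      uniform in time down to t = 0.\<close>
    moreover have "continuous_into_Linf {0..} (\<lambda>t k. c t k - heat t c\<^sub>0 k)"
    proof (rule continuous_map_LinfI)
      show "continuous_on {0..} (\<lambda>t. c t k - heat t c\<^sub>0 k)" for k
        unfolding heat_def by (intro continuous_intros continuous_on_subset [OF c_cont]) auto
      show "\<exists>S g. open S \<and> t \<in> S \<and> (g \<longlongrightarrow> 0) cofinite \<and>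
          (\<forall>s\<in>S \<inter> {0..}. \<forall>k. k \<noteq> 0 \<longrightarrow> norm (c s k - heat s c\<^sub>0 k) \<le> g k)" for t
        using d nonlinear_le c_eq by (intro exI [of _ UNIV] exI [of _ ?d]) auto
    qed
    moreover have "continuous_into_Linf {0..} c" if "(c\<^sub>0 \<longlongrightarrow> 0) cofinite"
    proof (rule continuous_map_LinfI)
      show "continuous_on {0..} (\<lambda>t. c t k)" for k
        by (rule continuous_on_subset [OF c_cont]) simp
      \<comment> \<open>The heat factor is at most 1, so the data themselves give a majorant that is
        uniform in time and, by assumption, tends to 0.\<close>
      let ?h = "\<lambda>k. norm (c\<^sub>0 k) + ?d k"
      have "norm (c s k) \<le> ?h k" if "0 \<le> s" "k \<noteq> 0" for s k
      proof -
        have "norm (heat s c\<^sub>0 k) \<le> 1 * norm (c\<^sub>0 k)"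
          unfolding heat_def norm_scaleR using that by (intro mult_right_mono) auto
        then show ?thesis using c_le [OF that] by simp
      qed
      moreover have "(?h \<longlongrightarrow> 0) cofinite"
        using tendsto_add [OF tendsto_norm_zero [OF that] d] by simp
      ultimately show "\<exists>S g. open S \<and> t \<in> S \<and> (g \<longlongrightarrow> 0) cofinite \<and>
          (\<forall>s\<in>S \<inter> {0..}. \<forall>k. k \<noteq> 0 \<longrightarrow> norm (c s k) \<le> g k)" for t
        by (intro exI [of _ UNIV] exI [of _ ?h]) auto
    qed
    ultimately show "\<exists>v c. ns_solution v\<^sub>0 v \<and>
       (\<forall>t\<ge>0. \<forall>k. k \<noteq> 0 \<longrightarrow> v t k = c t k /\<^sub>R znorm k powr \<alpha>) \<and>
       continuous_into_Linf {0<..} c \<and>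
       continuous_into_Linf {0..} (\<lambda>t k. c t k - heat t c\<^sub>0 k) \<and>
       ((c\<^sub>0 \<longlongrightarrow> 0) cofinite \<longrightarrow> continuous_into_Linf {0..} c)"
      by (intro exI [of _ u] exI [of _ c] conjI impI)
  qed
qed

end
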